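(* Let $\gamma=\mathcal{N}(0,I_d)$ and $H=\mathbb{E}_{\mathbf{x}\sim\gamma}\big[\mathbf{x}\,(\nabla\log p(\mathbf{x})+\mathbf{x})^\top\big]$. For every orthogonal matrix $R\in\mathbb{R}^{d\times d}$, $$\tilde I(\gamma,p_R)\ \ge\ \sum_{i=1}^d\big(RHR^\top\big)_{ii}^2.$$ Moreover, equality holds if $p=\mathcal{N}(0,\Sigma)$ for a positive definite $\Sigma$; in that case $H=I_d-\Sigma^{-1}$.
   Context: Standing assumptions: $p$ is a positive, continuously differentiable probability density on $\mathbb{R}^d$ with $|\log p(\mathbf{x})|\le c(1+\|\mathbf{x}\|_2^m)$ and $\|\nabla\log p(\mathbf{x})\|_2\le c(1+\|\mathbf{x}\|_2^m)$ for some $c>0,m\ge2$. For orthogonal $R$, $p_R(\mathbf{x})=p(R^\top\mathbf{x})$ is the density of $RX$, $X\sim p$. For a product density $q$, $\mathbb{E}_{q_{-i}}[f(\mathbf{x})]$ denotes the expectation over all coordinates other than $x_i$ under $q$ (a function of $x_i$), and the projected Fisher information is $\tilde I(q,p)=\sum_{i=1}^d \mathbb{E}_{q}\big[\big(\mathbb{E}_{q_{-i}}[\partial_i\log q(\mathbf{x})-\partial_i\log p(\mathbf{x})]\big)^2\big]$. *)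

theory Defs
  imports "HOL-Analysis.Analysis" "HOL-Probability.Probability"
begin

definition upd :: "real^'n \<Rightarrow> 'n \<Rightarrow> real \<Rightarrow> real^'n" where
  "upd x i t = (\<chi> j. if j = i then t else x $ j)"

definition partial :: "(real^'n \<Rightarrow> real) \<Rightarrow> 'n \<Rightarrow> real^'n \<Rightarrow> real" where
  "partial f i x = deriv (\<lambda>t. f (upd x i t)) (x $ i)"

definition grad_log :: "(real^'n \<Rightarrow> real) \<Rightarrow> real^'n \<Rightarrow> real^'n" where
  "grad_log f x = (\<chi> i. partial (\<lambda>y. ln (f y)) i x)"

definition expect :: "(real^'n \<Rightarrow> real) \<Rightarrow> (real^'n \<Rightarrow> real) \<Rightarrow> real" where
  "expect q f = integral\<^sup>L lborel (\<lambda>x. q x * f x)"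

definition prod_dens :: "('n::finite \<Rightarrow> real \<Rightarrow> real) \<Rightarrow> real^'n \<Rightarrow> real" where
  "prod_dens qs x = (\<Prod>i\<in>UNIV. qs i (x $ i))"

text \<open>E_{q_{-i}}[f] as a function of x_i = t: integrate over all coordinates other
  than i under the product density (coordinate i is fixed to t).\<close>
definition expect_minus :: "('n::finite \<Rightarrow> real \<Rightarrow> real) \<Rightarrow> (real^'n \<Rightarrow> real) \<Rightarrow> 'n \<Rightarrow> real \<Rightarrow> real" where
  "expect_minus qs f i t = expect (prod_dens qs) (\<lambda>y. f (upd y i t))"

definition proj_fisher :: "('n::finite \<Rightarrow> real \<Rightarrow> real) \<Rightarrow> (real^'n \<Rightarrow> real) \<Rightarrow> real" where
  "proj_fisher qs p = (\<Sum>i\<in>UNIV. expect (prod_dens qs)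
     (\<lambda>x. (expect_minus qs (\<lambda>y. partial (\<lambda>z. ln (prod_dens qs z)) i y - partial (\<lambda>z. ln (p z)) i y) i (x $ i))\<^sup>2))"

definition std_gauss_marg :: "'n \<Rightarrow> real \<Rightarrow> real" where
  "std_gauss_marg i t = std_normal_density t"

abbreviation std_gauss :: "real^'n::finite \<Rightarrow> real" where
  "std_gauss \<equiv> prod_dens std_gauss_marg"

definition rot_dens :: "(real^'n \<Rightarrow> real) \<Rightarrow> real^'n^'n \<Rightarrow> real^'n \<Rightarrow> real" where
  "rot_dens p R x = p (transpose R *v x)"

definition H_mat :: "(real^'n::finite \<Rightarrow> real) \<Rightarrow> real^'n^'n" where
  "H_mat p = (\<chi> j k. expect std_gauss (\<lambda>x. x $ j * (grad_log p x $ k + x $ k)))"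

definition pos_def :: "real^'n^'n \<Rightarrow> bool" where
  "pos_def S \<longleftrightarrow> transpose S = S \<and> (\<forall>x. x \<noteq> 0 \<longrightarrow> x \<bullet> (S *v x) > 0)"

definition gauss_density :: "real^'n::finite^'n \<Rightarrow> real^'n \<Rightarrow> real" where
  "gauss_density S x = (2 * pi) powr (- real CARD('n) / 2) / sqrt (det S)
      * exp (- (x \<bullet> (matrix_inv S *v x)) / 2)"

end

theory Submission
  imports Defs
begin

text \<open>
  Write \<open>f\<^sub>i\<close> for the \<open>i\<close>-th component of the score difference between \<open>\<gamma>\<close> and \<open>p\<^sub>R\<close>, and
  \<open>h\<^sub>i\<close> for its average over all coordinates but the \<open>i\<close>-th. Since \<open>\<gamma>\<close> is a product measure,
  \<open>E[x\<^sub>i h\<^sub>i(x\<^sub>i)] = E[x\<^sub>i f\<^sub>i(x)]\<close>, and by rotation invariance of \<open>\<gamma>\<close> the latter is the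
  \<open>i\<close>-th diagonal entry of \<open>- R H R\<^sup>T\<close>. As \<open>E[x\<^sub>i\<^sup>2] = 1\<close>, Cauchy--Schwarz gives
  \<open>E[h\<^sub>i\<^sup>2] \<ge> (R H R\<^sup>T)\<^sub>i\<^sub>i\<^sup>2\<close>. For a centred Gaussian \<open>p\<close> the function \<open>f\<^sub>i\<close> is linear, so
  \<open>h\<^sub>i\<close> is a multiple of \<open>x\<^sub>i\<close> and equality holds.
\<close>

section \<open>Orthogonal invariance of Lebesgue measure\<close>

lemma nn_integral_lborel_translate:
  fixes c :: "'a::euclidean_space"
  assumes [measurable]: "f \<in> borel_measurable borel"
  shows "(\<integral>\<^sup>+x. f (c + x) \<partial>lborel) = (\<integral>\<^sup>+x. f x \<partial>lborel)"
proof -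
  have "(\<integral>\<^sup>+x. f x \<partial>lborel) = (\<integral>\<^sup>+x. f x \<partial>distr lborel borel ((+) c))"
    by (simp only: lborel_distr_plus)
  then show ?thesis by (simp add: nn_integral_distr)
qed

lemma nn_integral_lborel_reflect:
  fixes c :: "'a::euclidean_space"
  assumes [measurable]: "f \<in> borel_measurable borel"
  shows "(\<integral>\<^sup>+x. f (c - x) \<partial>lborel) = (\<integral>\<^sup>+x. f x \<partial>lborel)"
proof -
  have "lborel = distr lborel borel (\<lambda>x::'a. c - x)"
    using lborel_affine[of "-1" c] by (simp add: density_1 one_ennreal_def[symmetric])
  then have "(\<integral>\<^sup>+x. f x \<partial>lborel) = (\<integral>\<^sup>+x. f x \<partial>distr lborel borel (\<lambda>x. c - x))"
    by simp
  then show ?thesis by (simp add: nn_integral_distr)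
qed

lemma orthogonal_transformation_borel_measurable:
  fixes T :: "'a::euclidean_space \<Rightarrow> 'a"
  assumes "orthogonal_transformation T"
  shows "T \<in> borel_measurable borel"
  using assms by (auto simp: orthogonal_transformation_def
      intro!: borel_measurable_continuous_onI linear_continuous_on linear_conv_bounded_linear[THEN iffD1])

text \<open>The proof is the uniqueness argument for Haar measure: writing \<open>f\<close> for the indicator of
  \<open>A\<close> and \<open>g\<close> for that of the unit ball, shifting first \<open>y\<close> by \<open>T x\<close> and then \<open>x\<close> by the
  preimage of \<open>- y\<close> turns \<open>\<integral>\<integral> f (T x) g y\<close> into \<open>\<integral>\<integral> f (T x - y) g (T x)\<close>, and \<open>g \<circ> T = g\<close>.\<close>

lemma lborel_distr_orthogonal_transformation:
  fixes T :: "'a::euclidean_space \<Rightarrow> 'a"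
  assumes T: "orthogonal_transformation T"
  shows "distr lborel borel T = lborel"
proof (rule measure_eqI)
  fix A :: "'a set" assume "A \<in> sets (distr lborel borel T)"
  then have [measurable]: "A \<in> sets borel" by simp
  have [measurable]: "T \<in> borel_measurable borel"
    using T by (rule orthogonal_transformation_borel_measurable)
  define f :: "'a \<Rightarrow> ennreal" where "f = indicator A"
  define g :: "'a \<Rightarrow> ennreal" where "g = indicator (ball 0 1)"
  have [measurable]: "f \<in> borel_measurable borel" "g \<in> borel_measurable borel"
    by (simp_all add: f_def g_def borel_measurable_indicator)
  have gT: "g (T x) = g x" for x
    using orthogonal_transformation_norm[OF T, of x] by (simp add: g_def indicator_def)
  have addT: "T (x + y) = T x + T y" for x y
    using T by (simp add: orthogonal_transformation_def linear_add)
  have shift: "(\<integral>\<^sup>+x. f (T x) * g (y + T x) \<partial>lborel) = (\<integral>\<^sup>+x. f (T x - y) * g (T x) \<partial>lborel)" for y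
  proof -
    obtain u where u: "T u = - y"
      using orthogonal_transformation_surj[OF T] by (metis surjD)
    have "(\<integral>\<^sup>+x. f (T x) * g (y + T x) \<partial>lborel) = (\<integral>\<^sup>+x. f (T (u + x)) * g (y + T (u + x)) \<partial>lborel)"
      by (rule nn_integral_lborel_translate[symmetric]) measurable
    then show ?thesis by (simp add: addT u)
  qed
  have "(\<integral>\<^sup>+x. f (T x) \<partial>lborel) * (\<integral>\<^sup>+y. g y \<partial>lborel) = (\<integral>\<^sup>+x. \<integral>\<^sup>+y. f (T x) * g y \<partial>lborel \<partial>lborel)"
    by (simp add: nn_integral_cmult nn_integral_multc)
  also have "\<dots> = (\<integral>\<^sup>+x. \<integral>\<^sup>+y. f (T x) * g (T x + y) \<partial>lborel \<partial>lborel)"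
    by (simp add: nn_integral_cmult nn_integral_lborel_translate)
  also have "\<dots> = (\<integral>\<^sup>+y. \<integral>\<^sup>+x. f (T x) * g (T x + y) \<partial>lborel \<partial>lborel)"
    by (rule lborel_pair.Fubini') measurable
  also have "\<dots> = (\<integral>\<^sup>+y. \<integral>\<^sup>+x. f (T x - y) * g (T x) \<partial>lborel \<partial>lborel)"
    using shift by (simp add: add.commute)
  also have "\<dots> = (\<integral>\<^sup>+x. \<integral>\<^sup>+y. f (T x - y) * g (T x) \<partial>lborel \<partial>lborel)"
    by (rule lborel_pair.Fubini') measurable
  also have "\<dots> = (\<integral>\<^sup>+y. f y \<partial>lborel) * (\<integral>\<^sup>+x. g x \<partial>lborel)"
    by (simp add: nn_integral_multc nn_integral_cmult nn_integral_lborel_reflect gT)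
  finally have "emeasure lborel (ball 0 1 :: 'a set) * (\<integral>\<^sup>+x. f (T x) \<partial>lborel)
      = emeasure lborel (ball 0 1 :: 'a set) * (\<integral>\<^sup>+x. f x \<partial>lborel)"
    by (simp add: g_def mult.commute)
  \<comment> \<open>The ball serves as test set because its indicator is invariant under
    \<open>T\<close> and its volume is positive and finite, so the factor can be cancelled.\<close>
  moreover have "emeasure lborel (ball 0 1 :: 'a set) \<noteq> 0"
    by (simp add: emeasure_ball less_imp_neq[OF unit_ball_vol_pos, symmetric] ennreal_eq_0_iff not_le)
  moreover have "emeasure lborel (ball 0 1 :: 'a set) \<noteq> \<infinity>"
    using emeasure_lborel_ball_finite[of "0::'a" 1] by simp
  ultimately have "(\<integral>\<^sup>+x. f (T x) \<partial>lborel) = (\<integral>\<^sup>+x. f x \<partial>lborel)"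
    by (simp add: ennreal_mult_cancel_left)
  moreover have "(\<integral>\<^sup>+x. f (T x) \<partial>lborel) = (\<integral>\<^sup>+x. f x \<partial>distr lborel borel T)"
    by (simp add: nn_integral_distr)
  ultimately show "emeasure (distr lborel borel T) A = emeasure lborel A"
    by (simp add: f_def)
qed simp

lemma
  fixes T :: "'a::euclidean_space \<Rightarrow> 'a" and f :: "'a \<Rightarrow> 'b::{banach, second_countable_topology}"
  assumes "orthogonal_transformation T" and "f \<in> borel_measurable borel"
  shows integral_lborel_orthogonal_transformation:
      "(\<integral>x. f (T x) \<partial>lborel) = (\<integral>x. f x \<partial>lborel)"
    and integrable_lborel_orthogonal_transformation:
      "integrable lborel (\<lambda>x. f (T x)) \<longleftrightarrow> integrable lborel f"
  using assms integral_distr[of T lborel borel f] integrable_distr_eq[of T lborel borel f]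
  by (simp_all add: orthogonal_transformation_borel_measurable lborel_distr_orthogonal_transformation)

text \<open>On vectors \<open>lborel\<close> is the image of a product measure indexed by
  \<open>Basis\<close>. Reindexing the factors by the basis vectors \<open>axis i 1\<close> reduces
  both claims to Fubini for finite products.\<close>

lemma
  fixes f :: "'n::finite \<Rightarrow> real \<Rightarrow> real"
  assumes f: "\<And>i. integrable lborel (f i)"
  shows integrable_lborel_prod_cart: "integrable lborel (\<lambda>x::real^'n. \<Prod>i\<in>UNIV. f i (x $ i))"
    and integral_lborel_prod_cart:
      "(\<integral>x. (\<Prod>i\<in>UNIV. f i (x $ i)) \<partial>(lborel :: (real^'n) measure)) = (\<Prod>i\<in>UNIV. \<integral>t. f i t \<partial>lborel)"
proof -
  interpret product_sigma_finite "\<lambda>_::real^'n. lborel :: real measure" ..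
  define F where "F b = f (axis_index b)" for b :: "real^'n"
  have F: "integrable lborel (F b)" for b by (simp add: F_def f)
  have [measurable]: "F b \<in> borel_measurable borel" for b
    using borel_measurable_integrable[OF F] by simp
  have Basis: "(Basis :: (real^'n) set) = (\<lambda>i. axis i 1) ` UNIV"
    by (auto simp: Basis_vec_def)
  have inj: "inj (\<lambda>i::'n. axis i (1::real))"
    by (auto simp: inj_on_def axis_eq_axis)
  have Fx: "F (axis i 1) = f i" for i by (simp add: F_def axis_index_axis)
  have eq: "(\<Prod>i\<in>UNIV. f i (x $ i)) = (\<Prod>b\<in>Basis. F b (x \<bullet> b))" for x :: "real^'n"
    unfolding Basis by (subst prod.reindex[OF inj]) (simp add: Fx inner_axis)
  have eq': "(\<Prod>i\<in>UNIV. \<integral>t. f i t \<partial>lborel) = (\<Prod>b\<in>Basis. \<integral>t. F b t \<partial>lborel)"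
    unfolding Basis by (subst prod.reindex[OF inj]) (simp add: Fx)
  have *: "(\<Prod>b\<in>Basis. F b ((\<Sum>b\<in>Basis. u b *\<^sub>R b) \<bullet> b)) = (\<Prod>b\<in>Basis. F b (u b))" for u
    by (intro prod.cong) (simp_all add: inner_sum_left_Basis)
  show "integrable lborel (\<lambda>x::real^'n. \<Prod>i\<in>UNIV. f i (x $ i))"
    unfolding eq by (subst lborel_def)
      (simp add: integrable_distr_eq * lborel_eq_real[symmetric] product_integrable_prod F)
  show "(\<integral>x. (\<Prod>i\<in>UNIV. f i (x $ i)) \<partial>(lborel :: (real^'n) measure)) = (\<Prod>i\<in>UNIV. \<integral>t. f i t \<partial>lborel)"
    unfolding eq eq' by (subst lborel_def)
      (simp add: integral_distr * lborel_eq_real[symmetric] product_integral_prod F)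
qed

section \<open>Gaussian expectations of functions of polynomial growth\<close>

lemma power2_norm_cart: "(norm x)\<^sup>2 = (\<Sum>i\<in>UNIV. (x $ i)\<^sup>2)" for x :: "real^'n"
  unfolding power2_norm_eq_inner inner_vec_def by (simp add: power2_eq_square)

text \<open>The product density depends on the norm alone; every use of rotation invariance below
  rests on this.\<close>

lemma std_gauss_eq:
  "std_gauss (x::real^'n) = (1 / sqrt (2 * pi)) ^ CARD('n) * exp (- (norm x)\<^sup>2 / 2)"
proof -
  have "exp (- (norm x)\<^sup>2 / 2) = (\<Prod>i\<in>UNIV. exp (- (x $ i)\<^sup>2 / 2))"
    by (simp add: power2_norm_cart exp_sum[symmetric] sum_divide_distrib sum_negf)
  then show ?thesis
    by (simp add: prod_dens_def std_gauss_marg_def std_normal_density_def prod.distrib power_divide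
        prod_dividef)
qed

lemma std_gauss_nonneg: "0 \<le> std_gauss (x::real^'n)"
  by (simp add: std_gauss_eq)

lemma std_gauss_measurable [measurable]: "std_gauss \<in> borel_measurable (borel :: (real^'n) measure)"
  unfolding std_gauss_eq[abs_def] by measurable

text \<open>The base \<open>1 + (norm x)\<^sup>2\<close> is at least 1, so exponents can be raised
  freely when bounds are combined, and it is dominated by a product of one-variable factors, which
  suits a product density.\<close>

definition poly_growth :: "(real^'n \<Rightarrow> real) \<Rightarrow> bool" where
  "poly_growth f \<longleftrightarrow> f \<in> borel_measurable borel \<and> (\<exists>C k. \<forall>x. \<bar>f x\<bar> \<le> C * (1 + (norm x)\<^sup>2) ^ k)"

lemma poly_growth_measurable: "poly_growth f \<Longrightarrow> f \<in> borel_measurable borel"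
  by (simp add: poly_growth_def)

lemma poly_growthE:
  assumes "poly_growth f"
  obtains C k where "C \<ge> 0" "\<And>x. \<bar>f x\<bar> \<le> C * (1 + (norm x)\<^sup>2) ^ k"
proof -
  obtain C k where *: "\<And>x. \<bar>f x\<bar> \<le> C * (1 + (norm x)\<^sup>2) ^ k"
    using assms by (auto simp: poly_growth_def)
  have "0 \<le> C" using *[of 0] by simp
  with * show ?thesis using that by blast
qed

lemma poly_growth_const: "poly_growth (\<lambda>_. c)"
  unfolding poly_growth_def by (intro conjI exI[of _ "\<bar>c\<bar>"] exI[of _ 0]) auto

lemma poly_growth_add:
  assumes "poly_growth f" "poly_growth g"
  shows "poly_growth (\<lambda>x. f x + g x)"
proof -
  obtain C k where f: "C \<ge> 0" "\<And>x. \<bar>f x\<bar> \<le> C * (1 + (norm x)\<^sup>2) ^ k"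
    using assms(1) by (rule poly_growthE) blast
  obtain D l where g: "D \<ge> 0" "\<And>x. \<bar>g x\<bar> \<le> D * (1 + (norm x)\<^sup>2) ^ l"
    using assms(2) by (rule poly_growthE) blast
  have "\<bar>f x + g x\<bar> \<le> (C + D) * (1 + (norm x)\<^sup>2) ^ (k + l)" for x
  proof -
    have "\<bar>f x\<bar> \<le> C * (1 + (norm x)\<^sup>2) ^ (k + l)"
      by (rule order_trans[OF f(2)]) (auto intro!: mult_left_mono power_increasing f)
    moreover have "\<bar>g x\<bar> \<le> D * (1 + (norm x)\<^sup>2) ^ (k + l)"
      by (rule order_trans[OF g(2)]) (auto intro!: mult_left_mono power_increasing g)
    ultimately show ?thesis by (simp add: distrib_right)
  qed
  then show ?thesis using assms by (auto simp: poly_growth_def)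
qed

lemma poly_growth_mult:
  assumes "poly_growth f" "poly_growth g"
  shows "poly_growth (\<lambda>x. f x * g x)"
proof -
  obtain C k where f: "C \<ge> 0" "\<And>x. \<bar>f x\<bar> \<le> C * (1 + (norm x)\<^sup>2) ^ k"
    using assms(1) by (rule poly_growthE) blast
  obtain D l where g: "D \<ge> 0" "\<And>x. \<bar>g x\<bar> \<le> D * (1 + (norm x)\<^sup>2) ^ l"
    using assms(2) by (rule poly_growthE) blast
  have "\<bar>f x * g x\<bar> \<le> (C * D) * (1 + (norm x)\<^sup>2) ^ (k + l)" for x
    using mult_mono[OF f(2)[of x] g(2)[of x]] f(1)
    by (simp add: abs_mult power_add mult_ac)
  then show ?thesis using assms by (auto simp: poly_growth_def)
qed

lemma poly_growth_minus: "poly_growth f \<Longrightarrow> poly_growth (\<lambda>x. - f x)"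
  using poly_growth_mult[OF poly_growth_const[of "-1"]] by simp

lemma poly_growth_diff: "poly_growth f \<Longrightarrow> poly_growth g \<Longrightarrow> poly_growth (\<lambda>x. f x - g x)"
  using poly_growth_add[OF _ poly_growth_minus, of f g] by simp

lemma poly_growth_sum: "(\<And>i. i \<in> I \<Longrightarrow> poly_growth (f i)) \<Longrightarrow> poly_growth (\<lambda>x. \<Sum>i\<in>I. f i x)"
  by (induction I rule: infinite_finite_induct) (auto intro: poly_growth_const poly_growth_add)

lemma le_one_plus_square: "(t::real) \<le> 1 + t\<^sup>2"
proof -
  have "0 \<le> (t - 1 / 2)\<^sup>2" by simp
  then have "t \<le> t\<^sup>2 + 1 / 4" by (simp add: power2_diff power_divide)
  then show ?thesis by simp
qed

lemma poly_growth_component: "poly_growth (\<lambda>x. x $ (i::'n::finite))"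
  unfolding poly_growth_def
proof (intro conjI exI allI)
  show "\<bar>x $ i\<bar> \<le> 1 * (1 + (norm x)\<^sup>2) ^ 1" for x :: "real^'n"
    using component_le_norm_cart[of x i] le_one_plus_square[of "norm x"] by simp
qed measurable

text \<open>Brings the bound with \<open>norm x ^ m\<close> from the growth hypothesis into the form
  of \<open>poly_growth\<close>.\<close>

lemma poly_growth_norm_power:
  fixes f :: "real^'n \<Rightarrow> real"
  assumes "f \<in> borel_measurable borel" and f: "\<And>x. \<bar>f x\<bar> \<le> c * (1 + norm x ^ m)" and "c \<ge> 0"
  shows "poly_growth f"
  unfolding poly_growth_def
proof (intro conjI exI allI)
  fix x :: "real^'n"
  have "norm x ^ m \<le> (1 + (norm x)\<^sup>2) ^ m"
    by (intro power_mono le_one_plus_square) simp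
  moreover have "1 \<le> (1 + (norm x)\<^sup>2) ^ m" by simp
  ultimately have "1 + norm x ^ m \<le> 2 * (1 + (norm x)\<^sup>2) ^ m" by linarith
  then have "c * (1 + norm x ^ m) \<le> c * (2 * (1 + (norm x)\<^sup>2) ^ m)"
    using \<open>c \<ge> 0\<close> by (rule mult_left_mono)
  then show "\<bar>f x\<bar> \<le> (2 * c) * (1 + (norm x)\<^sup>2) ^ m"
    using f[of x] by (simp add: mult_ac)
qed fact

lemma poly_growth_orthogonal_transformation:
  fixes T :: "real^'n \<Rightarrow> real^'n"
  assumes "poly_growth f" and T: "orthogonal_transformation T"
  shows "poly_growth (\<lambda>x. f (T x))"
proof -
  have [measurable]: "f \<in> borel_measurable borel" "T \<in> borel_measurable borel"
    using assms by (simp_all add: poly_growth_measurable orthogonal_transformation_borel_measurable)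
  obtain C k where "\<And>x. \<bar>f x\<bar> \<le> C * (1 + (norm x)\<^sup>2) ^ k"
    using assms(1) by (rule poly_growthE) blast
  from this[of "T _"] have "\<And>x. \<bar>f (T x)\<bar> \<le> C * (1 + (norm x)\<^sup>2) ^ k"
    by (simp add: orthogonal_transformation_norm[OF T])
  then show ?thesis unfolding poly_growth_def by auto
qed

text \<open>Expanding the product gives the left side plus nonnegative mixed terms. With squared
  coordinates for \<open>a\<close>, this separates the variables in
  \<open>1 + (norm x)\<^sup>2\<close>.\<close>

lemma one_plus_sum_le_prod_one_plus:
  fixes a :: "'i \<Rightarrow> real"
  assumes "finite I" "\<And>i. i \<in> I \<Longrightarrow> 0 \<le> a i"
  shows "1 + (\<Sum>i\<in>I. a i) \<le> (\<Prod>i\<in>I. 1 + a i)"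
  using assms
proof (induction I rule: finite_induct)
  case (insert j I)
  have "1 + (\<Sum>i\<in>insert j I. a i) \<le> (1 + a j) * (1 + (\<Sum>i\<in>I. a i))"
    using insert by (simp add: algebra_simps sum_nonneg)
  also have "\<dots> \<le> (1 + a j) * (\<Prod>i\<in>I. 1 + a i)"
    using insert by (intro mult_left_mono) auto
  finally show ?case using insert by simp
qed simp

text \<open>The integrand is dominated by a constant times a product of functions
  \<open>w (x $ i)\<close>, each a one-dimensional Gaussian density times a polynomial.\<close>

lemma integrable_std_gauss:
  fixes f :: "real^'n \<Rightarrow> real"
  assumes "poly_growth f"
  shows "integrable lborel (\<lambda>x. std_gauss x * f x)"
proof -
  have [measurable]: "f \<in> borel_measurable borel" by (rule poly_growth_measurable) fact
  obtain C k where C: "C \<ge> 0" "\<And>x. \<bar>f x\<bar> \<le> C * (1 + (norm x)\<^sup>2) ^ k"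
    using assms by (rule poly_growthE) blast
  define w where "w t = std_normal_density t * (1 + t\<^sup>2) ^ k" for t
  have w: "integrable lborel w"
  proof -
    \<comment> \<open>The binomial theorem reduces integrability of \<open>w\<close> to that of the
      even Gaussian moments.\<close>
    have "w t = (\<Sum>j\<le>k. real (k choose j) * (std_normal_density t * t ^ (2 * j)))" for t
      using binomial_ring[of "t\<^sup>2" 1 k]
      by (simp add: w_def add.commute[of 1] sum_distrib_left power_mult mult.left_commute)
    then have "w = (\<lambda>t. \<Sum>j\<le>k. real (k choose j) * (std_normal_density t * t ^ (2 * j)))"
      by (rule ext)
    then show ?thesis
      by (simp add: integrable_std_normal_moment)
  qed
  show ?thesis
  proof (rule Bochner_Integration.integrable_bound)
    show "integrable lborel (\<lambda>x::real^'n. C * (\<Prod>i\<in>UNIV. w (x $ i)))"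
      using w by (intro integrable_mult_right integrable_lborel_prod_cart)
    show "AE x in lborel. norm (std_gauss x * f x) \<le> norm (C * (\<Prod>i\<in>UNIV. w (x $ i)))"
    proof (rule AE_I2)
      fix x :: "real^'n"
      have "1 + (norm x)\<^sup>2 \<le> (\<Prod>i\<in>UNIV. 1 + (x $ i)\<^sup>2)"
        using one_plus_sum_le_prod_one_plus[of UNIV "\<lambda>i. (x $ i)\<^sup>2"]
        by (simp add: power2_norm_cart)
      then have "(1 + (norm x)\<^sup>2) ^ k \<le> (\<Prod>i\<in>UNIV. 1 + (x $ i)\<^sup>2) ^ k"
        by (intro power_mono) auto
      then have "C * (1 + (norm x)\<^sup>2) ^ k \<le> C * (\<Prod>i\<in>UNIV. 1 + (x $ i)\<^sup>2) ^ k"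
        using C(1) by (rule mult_left_mono)
      with C(2)[of x] have "\<bar>f x\<bar> \<le> C * (\<Prod>i\<in>UNIV. 1 + (x $ i)\<^sup>2) ^ k" by linarith
      then have "std_gauss x * \<bar>f x\<bar> \<le> std_gauss x * (C * (\<Prod>i\<in>UNIV. 1 + (x $ i)\<^sup>2) ^ k)"
        using std_gauss_nonneg by (rule mult_left_mono)
      also have "\<dots> = C * (\<Prod>i\<in>UNIV. w (x $ i))"
        by (simp add: w_def prod.distrib prod_power_distrib prod_dens_def std_gauss_marg_def)
      finally have "\<bar>std_gauss x * f x\<bar> \<le> C * (\<Prod>i\<in>UNIV. w (x $ i))"
        by (simp add: abs_mult std_gauss_nonneg)
      then show "norm (std_gauss x * f x) \<le> norm (C * (\<Prod>i\<in>UNIV. w (x $ i)))"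
        by simp
    qed
  qed measurable
qed

lemma expect_std_gauss_add:
  "poly_growth f \<Longrightarrow> poly_growth g \<Longrightarrow>
    expect std_gauss (\<lambda>x. f x + g x) = expect std_gauss f + expect std_gauss g"
  by (simp add: expect_def distrib_left integrable_std_gauss)

lemma expect_cmult: "expect q (\<lambda>x. c * f x) = c * expect q f"
  by (simp add: expect_def mult.left_commute)

lemma expect_uminus: "expect q (\<lambda>x. - f x) = - expect q f"
  by (simp add: expect_def)

lemma expect_std_gauss_sum:
  "(\<And>i. i \<in> I \<Longrightarrow> poly_growth (f i)) \<Longrightarrow>
    expect std_gauss (\<lambda>x. \<Sum>i\<in>I. f i x) = (\<Sum>i\<in>I. expect std_gauss (f i))"
  by (simp add: expect_def sum_distrib_left integrable_std_gauss)

lemma expect_std_gauss_mono: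
  "poly_growth f \<Longrightarrow> poly_growth g \<Longrightarrow> (\<And>x. f x \<le> g x) \<Longrightarrow> expect std_gauss f \<le> expect std_gauss g"
  by (simp add: expect_def integral_mono integrable_std_gauss mult_left_mono std_gauss_nonneg)

text \<open>Both the density and Lebesgue measure are invariant under \<open>T\<close>.\<close>

lemma expect_std_gauss_orthogonal_transformation:
  fixes T :: "real^'n \<Rightarrow> real^'n"
  assumes [measurable]: "f \<in> borel_measurable borel" and T: "orthogonal_transformation T"
  shows "expect std_gauss (\<lambda>x. f (T x)) = expect std_gauss f"
proof -
  have "std_gauss x = std_gauss (T x)" for x
    by (simp add: std_gauss_eq orthogonal_transformation_norm[OF T])
  then have "expect std_gauss (\<lambda>x. f (T x)) = (\<integral>x. std_gauss (T x) * f (T x) \<partial>lborel)"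
    by (simp add: expect_def)
  also have "\<dots> = expect std_gauss f"
    unfolding expect_def by (rule integral_lborel_orthogonal_transformation[OF T]) measurable
  finally show ?thesis .
qed

section \<open>Moments of the standard Gaussian up to order two\<close>

lemma std_normal_integrals:
  "integrable lborel std_normal_density" "(\<integral>t. std_normal_density t \<partial>lborel) = 1"
  "integrable lborel (\<lambda>t. std_normal_density t * t)" "(\<integral>t. std_normal_density t * t \<partial>lborel) = 0"
  "integrable lborel (\<lambda>t. std_normal_density t * t\<^sup>2)" "(\<integral>t. std_normal_density t * t\<^sup>2 \<partial>lborel) = 1"
  using integrable_std_normal_moment[of 0] integral_std_normal_moment_even[of 0]
    integrable_std_normal_moment[of 1] integral_std_normal_moment_odd[of 0]
    integrable_std_normal_moment[of 2] integral_std_normal_moment_even[of 1]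
  by (simp_all add: fact_numeral)

lemma expect_std_gauss_const: "expect (std_gauss :: real^'n \<Rightarrow> real) (\<lambda>_. c) = c"
proof -
  have "expect (std_gauss :: real^'n \<Rightarrow> real) (\<lambda>_. 1) = 1"
    using integral_lborel_prod_cart[of "\<lambda>_::'n. std_normal_density", OF std_normal_integrals(1)]
      std_normal_integrals(2)
    by (simp add: expect_def prod_dens_def std_gauss_marg_def)
  then show ?thesis
    using expect_cmult[of "std_gauss :: real^'n \<Rightarrow> real" c "\<lambda>_. 1"] by simp
qed

lemma expect_std_gauss_component: "expect std_gauss (\<lambda>x. x $ (j::'n::finite)) = 0"
proof -
  define f where "f i t = std_normal_density t * (if i = j then t else 1)" for i :: 'n and t
  have f: "integrable lborel (f i)" "(\<integral>t. f i t \<partial>lborel) = (if i = j then 0 else 1)" for i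
    using std_normal_integrals(1-4) unfolding f_def[abs_def] by (cases "i = j"; simp)+
  have "std_gauss x * x $ j = (\<Prod>i\<in>UNIV. f i (x $ i))" for x
    by (simp add: f_def prod.distrib prod_dens_def std_gauss_marg_def)
  then show ?thesis
    unfolding expect_def by (simp add: integral_lborel_prod_cart f)
qed

lemma expect_std_gauss_component_mult:
  "expect std_gauss (\<lambda>x. x $ j * x $ k) = (if j = k then 1 else 0)" for j k :: "'n::finite"
proof -
  define f where "f i t = std_normal_density t * ((if i = j then t else 1) * (if i = k then t else 1))"
    for i :: 'n and t :: real
  have f: "integrable lborel (f i)"
    \<comment> \<open>The condition says that \<open>i\<close> matches both or neither of
      \<open>j\<close> and \<open>k\<close>: the factor is then a moment of order 2 or 0, which is
      1. Otherwise it is the first moment, which is 0.\<close>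
    "(\<integral>t. f i t \<partial>lborel) = (if (i = j) = (i = k) then 1 else 0)" for i
    using std_normal_integrals[unfolded power2_eq_square]
    unfolding f_def[abs_def] by (cases "i = j"; cases "i = k"; simp)+
  have "std_gauss x * (x $ j * x $ k) = (\<Prod>i\<in>UNIV. f i (x $ i))" for x
    by (simp add: f_def prod.distrib prod_dens_def std_gauss_marg_def)
  then have "expect std_gauss (\<lambda>x. x $ j * x $ k) = (\<Prod>i\<in>UNIV. if (i = j) = (i = k) then 1 else 0)"
    unfolding expect_def by (simp add: integral_lborel_prod_cart f)
  moreover have "(\<Prod>i\<in>UNIV. if (i = j) = (i = k) then 1 else 0) = (0::real)" if "j \<noteq> k"
    using that by (intro prod_zero) auto
  ultimately show ?thesis by (cases "j = k") simp_all
qed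

section \<open>Projection onto one coordinate\<close>

lemma upd_component [simp]: "upd x i t $ j = (if j = i then t else x $ j)"
  by (simp add: upd_def)

lemma upd_same [simp]: "upd x i (x $ i) = x"
  by (simp add: vec_eq_iff)

lemma upd_eq: "upd x i t = x + (t - x $ i) *\<^sub>R axis i 1"
  by (simp add: vec_eq_iff axis_def)

lemma upd_measurable [measurable]:
  assumes [measurable]: "f \<in> borel_measurable M" "g \<in> borel_measurable M"
  shows "(\<lambda>x. upd (f x :: real^'n) i (g x)) \<in> borel_measurable M"
proof -
  have [measurable]: "(\<lambda>x. f x $ i) \<in> borel_measurable M"
    by (rule borel_measurable_continuous_on[OF _ assms(1)]) (intro continuous_intros)
  show ?thesis unfolding upd_eq by measurable
qed

lemma power2_norm_upd_le: "(norm (upd x i t))\<^sup>2 \<le> (norm x)\<^sup>2 + t\<^sup>2" for x :: "real^'n"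
proof -
  have "(norm (upd x i t))\<^sup>2 = (\<Sum>j\<in>UNIV. (upd x i t $ j)\<^sup>2)"
    by (rule power2_norm_cart)
  also have "\<dots> \<le> (\<Sum>j\<in>UNIV. (x $ j)\<^sup>2 + (if j = i then t\<^sup>2 else 0))"
    by (intro sum_mono) auto
  also have "\<dots> = (norm x)\<^sup>2 + t\<^sup>2"
    by (simp add: sum.distrib power2_norm_cart)
  finally show ?thesis .
qed

lemma orthogonal_transformation_swap_coordinate:
  "orthogonal_transformation (\<lambda>z::(real^'n) \<times> (real^'n).
     (upd (fst z) i (snd z $ i), upd (snd z) i (fst z $ i)))"
  unfolding orthogonal_transformation_def
proof (intro conjI allI)
  show "linear (\<lambda>z::(real^'n) \<times> (real^'n). (upd (fst z) i (snd z $ i), upd (snd z) i (fst z $ i)))"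
    by (rule linearI) (auto simp: vec_eq_iff)
  fix v w :: "(real^'n) \<times> (real^'n)"
  show "(upd (fst v) i (snd v $ i), upd (snd v) i (fst v $ i)) \<bullet>
      (upd (fst w) i (snd w $ i), upd (snd w) i (fst w $ i)) = v \<bullet> w"
    by (cases v; cases w) (auto simp: inner_vec_def sum.distrib[symmetric] intro!: sum.cong)
qed

text \<open>Swapping the \<open>i\<close>-th coordinates of two independent copies is an orthogonal map of the
  product space, hence preserves \<open>\<gamma> \<otimes> \<gamma>\<close>.\<close>

lemma expect_std_gauss_resample:
  fixes f :: "real^'n \<Rightarrow> real"
  assumes f: "poly_growth f"
  shows "expect std_gauss (\<lambda>x. expect_minus std_gauss_marg f i (x $ i)) = expect std_gauss f"
proof -
  have [measurable]: "f \<in> borel_measurable borel"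
    using f by (rule poly_growth_measurable)
  \<comment> \<open>\<open>K\<close> is the integrand for two independent Gaussian copies, with
    \<open>f\<close> evaluated at the second one.\<close>
  define K where "K z = std_gauss (fst z) * (std_gauss (snd z) * f (snd z))"
    for z :: "(real^'n) \<times> (real^'n)"
  define T where "T z = (upd (fst z) i (snd z $ i), upd (snd z) i (fst z $ i))"
    for z :: "(real^'n) \<times> (real^'n)"
  have T: "orthogonal_transformation T"
    using orthogonal_transformation_swap_coordinate[of i] by (simp add: T_def[abs_def])
  have K_meas: "K \<in> borel_measurable borel"
    unfolding K_def[abs_def] borel_prod[symmetric] by measurable
  have K: "integrable (lborel \<Otimes>\<^sub>M lborel) K"
  proof (rule lborel_pair.Fubini_integrable)
    show "K \<in> borel_measurable (lborel \<Otimes>\<^sub>M lborel)"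
      unfolding K_def[abs_def] by measurable
    have "integrable lborel (\<lambda>x::real^'n. std_gauss x * 1)"
      by (rule integrable_std_gauss[OF poly_growth_const])
    then show "integrable lborel (\<lambda>x. LBINT y. norm (K (x, y)))"
      by (simp add: K_def abs_mult std_gauss_nonneg)
    show "AE x in lborel. integrable lborel (\<lambda>y. K (x, y))"
      by (simp add: K_def integrable_std_gauss[OF f])
  qed
  then have K': "integrable lborel K" by (simp add: lborel_prod)
  have "integrable lborel (\<lambda>z. K (T z))"
    using integrable_lborel_orthogonal_transformation[OF T K_meas] K' by simp
  then have KT: "integrable (lborel \<Otimes>\<^sub>M lborel) (\<lambda>z. K (T z))" by (simp add: lborel_prod)
  \<comment> \<open>The joint density is a function of the norm of the pair, which \<open>T\<close>
    preserves.\<close>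
  have std_gauss_mult: "std_gauss x * std_gauss y = ((1 / sqrt (2 * pi)) ^ CARD('n))\<^sup>2 * exp (- (norm (x, y))\<^sup>2 / 2)"
    for x y :: "real^'n"
    by (simp add: std_gauss_eq norm_Pair exp_add[symmetric] power2_eq_square add_divide_distrib)
  have inv: "std_gauss (upd x i (y $ i)) * std_gauss (upd y i (x $ i)) = std_gauss x * std_gauss y"
    for x y :: "real^'n"
    using orthogonal_transformation_norm[OF T, of "(x, y)"] by (simp add: std_gauss_mult T_def)
  \<comment> \<open>After the swap, \<open>f\<close> sees the second copy with its
    \<open>i\<close>-th coordinate taken from the first. Integrating over all of \<open>y\<close> is
    exactly \<open>expect_minus\<close> at \<open>x $ i\<close>.\<close>
  have "K (T (x, y)) = std_gauss x * (std_gauss y * f (upd y i (x $ i)))" for x y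
    unfolding K_def T_def using inv[of x y] by (simp add: mult.assoc[symmetric])
  then have "expect std_gauss (\<lambda>x. expect_minus std_gauss_marg f i (x $ i))
      = (\<integral>x. \<integral>y. K (T (x, y)) \<partial>lborel \<partial>lborel)"
    by (simp add: expect_def expect_minus_def)
  also have "\<dots> = (\<integral>z. K (T z) \<partial>lborel)"
    using lborel_pair.integral_fst'[OF KT] by (simp add: lborel_prod)
  also have "\<dots> = (\<integral>z. K z \<partial>lborel)"
    by (rule integral_lborel_orthogonal_transformation[OF T K_meas])
  also have "\<dots> = (\<integral>x. \<integral>y. K (x, y) \<partial>lborel \<partial>lborel)"
    using lborel_pair.integral_fst'[OF K] by (simp add: lborel_prod)
  also have "\<dots> = expect (std_gauss :: real^'n \<Rightarrow> real) (\<lambda>_. expect std_gauss f)"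
    by (simp add: K_def expect_def)
  also have "\<dots> = expect std_gauss f" by (rule expect_std_gauss_const)
  finally show ?thesis .
qed

text \<open>Since \<open>1 + (norm (upd y i t))\<^sup>2\<close> is at most
  \<open>(1 + t\<^sup>2) * (1 + (norm y)\<^sup>2)\<close>, the bound on \<open>f\<close> factors;
  integrating out \<open>y\<close> leaves the finite constant \<open>D\<close> times a power of
  \<open>1 + t\<^sup>2\<close>.\<close>

lemma poly_growth_expect_minus:
  fixes f :: "real^'n \<Rightarrow> real"
  assumes f: "poly_growth f"
  shows "poly_growth (\<lambda>x. expect_minus std_gauss_marg f i (x $ i))"
proof -
  have [measurable]: "f \<in> borel_measurable borel"
    using f by (rule poly_growth_measurable)
  obtain C k where C: "C \<ge> 0" "\<And>x. \<bar>f x\<bar> \<le> C * (1 + (norm x)\<^sup>2) ^ k"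
    using f by (rule poly_growthE) blast
  define w where "w x = (1 + (norm x)\<^sup>2) ^ k" for x :: "real^'n"
  have w: "poly_growth w"
    unfolding poly_growth_def w_def[abs_def] by (intro conjI exI[of _ 1] exI[of _ k]) auto
  define D where "D = C * expect std_gauss w"
  have D: "D \<ge> 0"
    using C(1) unfolding D_def expect_def
    by (intro mult_nonneg_nonneg integral_nonneg) (auto simp: w_def std_gauss_nonneg)
  have bound: "\<bar>expect_minus std_gauss_marg f i t\<bar> \<le> D * (1 + t\<^sup>2) ^ k" for t
  proof -
    have le: "\<bar>f (upd y i t)\<bar> \<le> (C * (1 + t\<^sup>2) ^ k) * w y" for y
    proof -
      have "1 + (norm (upd y i t))\<^sup>2 \<le> (1 + t\<^sup>2) * (1 + (norm y)\<^sup>2)"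
        using power2_norm_upd_le[of y i t] mult_nonneg_nonneg[OF zero_le_power2[of t] zero_le_power2[of "norm y"]]
        unfolding distrib_right distrib_left by linarith
      then have "C * (1 + (norm (upd y i t))\<^sup>2) ^ k \<le> C * ((1 + t\<^sup>2) * (1 + (norm y)\<^sup>2)) ^ k"
        using C(1) by (intro mult_left_mono power_mono) auto
      then show ?thesis
        using C(2)[of "upd y i t"] by (simp add: w_def power_mult_distrib mult_ac)
    qed
    have "\<bar>expect_minus std_gauss_marg f i t\<bar> \<le> (\<integral>y. \<bar>std_gauss y * f (upd y i t)\<bar> \<partial>lborel)"
      unfolding expect_minus_def expect_def by (rule integral_abs_bound)
    also have "\<dots> \<le> (\<integral>y. std_gauss y * ((C * (1 + t\<^sup>2) ^ k) * w y) \<partial>lborel)"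
    proof (rule integral_mono')
      show "integrable lborel (\<lambda>y. std_gauss y * ((C * (1 + t\<^sup>2) ^ k) * w y))"
        by (intro integrable_std_gauss poly_growth_mult poly_growth_const w)
    qed (use le C(1) in \<open>auto simp: abs_mult std_gauss_nonneg w_def intro!: mult_left_mono\<close>)
    also have "\<dots> = D * (1 + t\<^sup>2) ^ k"
      using expect_cmult[of std_gauss "C * (1 + t\<^sup>2) ^ k" w] by (simp add: expect_def D_def mult_ac)
    finally show ?thesis .
  qed
  have [measurable]: "expect_minus std_gauss_marg f i \<in> borel_measurable borel"
    unfolding expect_minus_def[abs_def] expect_def by measurable
  show ?thesis
    unfolding poly_growth_def
  proof (intro conjI exI allI)
    fix x :: "real^'n"
    have "(1 + (x $ i)\<^sup>2) ^ k \<le> (1 + (norm x)\<^sup>2) ^ k"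
      using component_le_norm_cart[of x i] abs_le_square_iff[of "x $ i" "norm x"]
      by (intro power_mono) auto
    then show "\<bar>expect_minus std_gauss_marg f i (x $ i)\<bar> \<le> D * (1 + (norm x)\<^sup>2) ^ k"
      using bound[of "x $ i"] mult_left_mono[OF _ D] by (meson order_trans)
  qed measurable
qed

text \<open>The coordinate \<open>x $ i\<close> is held fixed while the others are averaged, so it
  passes through \<open>expect_minus\<close>.\<close>

lemma expect_component_expect_minus:
  fixes f :: "real^'n \<Rightarrow> real"
  assumes "poly_growth f"
  shows "expect std_gauss (\<lambda>x. x $ i * expect_minus std_gauss_marg f i (x $ i))
    = expect std_gauss (\<lambda>x. x $ i * f x)"
proof -
  have "expect_minus std_gauss_marg (\<lambda>x. x $ i * f x) i t = t * expect_minus std_gauss_marg f i t" for t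
    by (simp add: expect_minus_def expect_cmult)
  then show ?thesis
    using expect_std_gauss_resample[OF poly_growth_mult[OF poly_growth_component[of i] assms], of i]
    by simp
qed

text \<open>Cauchy--Schwarz against the coordinate \<open>x\<^sub>i\<close>, which has unit second moment.\<close>

lemma expect_expect_minus_square_ge:
  fixes f :: "real^'n \<Rightarrow> real"
  assumes f: "poly_growth f"
  shows "(expect std_gauss (\<lambda>x. x $ i * f x))\<^sup>2
    \<le> expect std_gauss (\<lambda>x. (expect_minus std_gauss_marg f i (x $ i))\<^sup>2)"
proof -
  define h where "h x = expect_minus std_gauss_marg f i (x $ i)" for x
  define a where "a = expect std_gauss (\<lambda>x. x $ i * f x)"
  note growth = poly_growth_add poly_growth_mult poly_growth_const poly_growth_component
  have h: "poly_growth h"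
    using poly_growth_expect_minus[OF f] by (simp add: h_def[abs_def])
  \<comment> \<open>This is the integrated form of \<open>0 \<le> (h x - a * x $ i)\<^sup>2\<close>.
    The coefficient \<open>a\<close> is the correlation of \<open>h\<close> with
    \<open>x $ i\<close>, so the left side evaluates to
    \<open>2 * a\<^sup>2 - a\<^sup>2\<close>.\<close>
  have "expect std_gauss (\<lambda>x. (2 * a) * (x $ i * h x) + (- a\<^sup>2) * (x $ i * x $ i))
      \<le> expect std_gauss (\<lambda>x. h x * h x)"
  proof (rule expect_std_gauss_mono)
    fix x
    have "0 \<le> (h x - a * x $ i)\<^sup>2" by simp
    then show "(2 * a) * (x $ i * h x) + (- a\<^sup>2) * (x $ i * x $ i) \<le> h x * h x"
      by (simp add: power2_eq_square algebra_simps)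
  qed (intro growth h)+
  moreover have "expect std_gauss (\<lambda>x. (2 * a) * (x $ i * h x) + (- a\<^sup>2) * (x $ i * x $ i)) = a\<^sup>2"
    by (subst expect_std_gauss_add; (intro growth h)?)
      (simp only: expect_cmult expect_component_expect_minus[OF f] h_def expect_std_gauss_component_mult
        a_def[symmetric], simp add: power2_eq_square)
  ultimately show ?thesis by (simp add: h_def a_def power2_eq_square)
qed

text \<open>The equality case: the other coordinates have mean zero, so the projection is
  \<open>a $ i * t\<close>, and both sides equal \<open>(a $ i)\<^sup>2\<close>.\<close>

lemma expect_expect_minus_square_linear:
  fixes a :: "real^'n"
  shows "expect std_gauss (\<lambda>x. (expect_minus std_gauss_marg (\<lambda>x. a \<bullet> x) i (x $ i))\<^sup>2)
    = (expect std_gauss (\<lambda>x. x $ i * (a \<bullet> x)))\<^sup>2"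
proof -
  note growth = poly_growth_sum poly_growth_mult poly_growth_const poly_growth_component
  have "expect_minus std_gauss_marg (\<lambda>x. a \<bullet> x) i t = a $ i * t" for t
  proof -
    have "poly_growth (\<lambda>y. a $ j * (if j = i then t else y $ j))" for j :: 'n
      by (cases "j = i") (auto intro: growth)
    then have "expect_minus std_gauss_marg (\<lambda>x. a \<bullet> x) i t
        = (\<Sum>j\<in>UNIV. a $ j * expect std_gauss (\<lambda>y. if j = i then t else y $ j))"
      by (simp add: expect_minus_def inner_vec_def expect_std_gauss_sum expect_cmult)
    also have "\<dots> = (\<Sum>j\<in>UNIV. if j = i then a $ j * t else 0)"
      by (intro sum.cong) (auto simp: expect_std_gauss_const expect_std_gauss_component)
    finally show ?thesis by simp
  qed
  moreover have "expect std_gauss (\<lambda>x. (a $ i * x $ i)\<^sup>2) = (a $ i)\<^sup>2"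
    by (simp add: power_mult_distrib expect_cmult)
      (simp add: power2_eq_square expect_std_gauss_component_mult)
  moreover have "expect std_gauss (\<lambda>x. x $ i * (a \<bullet> x)) = a $ i"
  proof -
    have "expect std_gauss (\<lambda>x. x $ i * (a \<bullet> x)) = expect std_gauss (\<lambda>x. \<Sum>j\<in>UNIV. a $ j * (x $ i * x $ j))"
      by (simp add: inner_vec_def sum_distrib_left mult_ac)
    also have "\<dots> = (\<Sum>j\<in>UNIV. a $ j * expect std_gauss (\<lambda>x. x $ i * x $ j))"
      by (subst expect_std_gauss_sum) (intro growth, simp add: expect_cmult)
    finally show ?thesis by (simp add: expect_std_gauss_component_mult if_distrib cong: if_cong)
  qed
  ultimately show ?thesis by simp
qed

section \<open>Coordinate derivatives and the Gaussian score\<close>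

lemma partial_eq:
  assumes "(f has_derivative D) (at x)"
  shows "partial f i x = D (axis i 1)"
proof -
  interpret D: bounded_linear D using assms by (rule has_derivative_bounded_linear)
  \<comment> \<open>\<open>partial\<close> differentiates along the line \<open>upd x i t\<close>,
    whose velocity is \<open>axis i 1\<close>; the claim is then the chain rule.\<close>
  have "((\<lambda>t. upd x i t) has_derivative (\<lambda>s. s *\<^sub>R axis i 1)) (at (x $ i))"
    unfolding upd_eq by (auto intro!: derivative_eq_intros)
  moreover have "(f has_derivative D) (at (upd x i (x $ i)))" using assms by simp
  ultimately have "((\<lambda>t. f (upd x i t)) has_derivative (\<lambda>s. D (s *\<^sub>R axis i 1))) (at (x $ i))"
    by (rule has_derivative_compose)
  then have "((\<lambda>t. f (upd x i t)) has_real_derivative D (axis i 1)) (at (x $ i))"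
    by (simp add: has_field_derivative_def D.scaleR mult_commute_abs)
  then show ?thesis unfolding partial_def by (rule DERIV_imp_deriv)
qed

lemma partial_ln_std_gauss: "partial (\<lambda>z. ln (std_gauss z)) i x = - x $ i" for x :: "real^'n"
proof -
  define c where "c = ln ((1 / sqrt (2 * pi)) ^ CARD('n))"
  have "ln (std_gauss z) = c - z \<bullet> z / 2" for z :: "real^'n"
    unfolding std_gauss_eq c_def by (subst ln_mult) (simp_all add: power2_norm_eq_inner)
  moreover have "((\<lambda>z. c - z \<bullet> z / 2) has_derivative (\<lambda>h. - (x \<bullet> h))) (at x)"
    by (auto intro!: derivative_eq_intros simp: inner_commute)
  ultimately show ?thesis
    by (simp add: partial_eq inner_axis)
qed

section \<open>Scores of rotated densities\<close>

text \<open>Keeps the form \<open>transpose R *v x\<close>, in which \<open>rot_dens\<close> is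
  written, rather than \<open>x v* R\<close>.\<close>

declare transpose_matrix_vector [simp del]

lemma has_derivative_ln_gradient:
  fixes p :: "real^'n \<Rightarrow> real"
  assumes "(p has_derivative (\<lambda>h. g \<bullet> h)) (at x)" "p x > 0"
  shows "((\<lambda>x. ln (p x)) has_derivative (\<lambda>h. (g /\<^sub>R p x) \<bullet> h)) (at x)"
  using assms by (auto intro!: derivative_eq_intros)

lemma grad_log_eq:
  fixes G :: "real^'n"
  assumes "((\<lambda>x. ln (p x)) has_derivative (\<lambda>h. G \<bullet> h)) (at x)"
  shows "grad_log p x = G"
  using partial_eq[OF assms] by (simp add: grad_log_def vec_eq_iff inner_axis)

lemma orthogonal_transformation_matrix_transpose:
  fixes R :: "real^'n^'n"
  assumes "orthogonal_matrix R"
  shows "orthogonal_transformation (\<lambda>x. transpose R *v x)"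
  using assms by (simp add: orthogonal_transformation_matrix orthogonal_matrix_transpose)

text \<open>By the chain rule the derivative in direction \<open>h\<close> is \<open>G\<close>
  paired with \<open>transpose R *v h\<close>; moving the transpose across the inner product puts
  \<open>R\<close> in front of the gradient.\<close>

lemma partial_ln_rot_dens:
  fixes G :: "real^'n \<Rightarrow> real^'n"
  assumes G: "\<And>x. ((\<lambda>x. ln (p x)) has_derivative (\<lambda>h. G x \<bullet> h)) (at x)"
  shows "partial (\<lambda>z. ln (rot_dens p R z)) i x = (R *v G (transpose R *v x)) $ i"
proof -
  have "((\<lambda>z. transpose R *v z) has_derivative (\<lambda>h. transpose R *v h)) (at x)"
    by (rule bounded_linear_imp_has_derivative) (rule matrix_vector_mul_bounded_linear)
  from has_derivative_compose[OF this G]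
  have "((\<lambda>z. ln (rot_dens p R z)) has_derivative (\<lambda>h. G (transpose R *v x) \<bullet> (transpose R *v h))) (at x)"
    by (simp add: rot_dens_def)
  then have "partial (\<lambda>z. ln (rot_dens p R z)) i x = G (transpose R *v x) \<bullet> (transpose R *v axis i 1)"
    by (rule partial_eq)
  also have "\<dots> = (R *v G (transpose R *v x)) \<bullet> axis i 1"
    by (metis dot_lmul_matrix vector_transpose_matrix)
  finally show ?thesis by (simp add: inner_axis)
qed

lemma proj_fisher_rot_dens:
  fixes G :: "real^'n \<Rightarrow> real^'n"
  assumes G: "\<And>x. ((\<lambda>x. ln (p x)) has_derivative (\<lambda>h. G x \<bullet> h)) (at x)"
  shows "proj_fisher std_gauss_marg (rot_dens p R) = (\<Sum>i\<in>UNIV. expect std_gauss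
    (\<lambda>x. (expect_minus std_gauss_marg (\<lambda>y. - y $ i - (R *v G (transpose R *v y)) $ i) i (x $ i))\<^sup>2))"
  unfolding proj_fisher_def by (simp add: partial_ln_rot_dens[OF G] partial_ln_std_gauss)

lemma poly_growth_matrix_vector_component:
  assumes "\<And>k. poly_growth (\<lambda>x. G x $ k)"
  shows "poly_growth (\<lambda>x. (R *v G x) $ i)"
  unfolding matrix_vector_mult_def using assms
  by (auto intro!: poly_growth_sum poly_growth_mult poly_growth_const)

lemma poly_growth_score_difference:
  fixes R :: "real^'n^'n"
  assumes R: "orthogonal_matrix R" and G: "\<And>k. poly_growth (\<lambda>x. G x $ k)"
  shows "poly_growth (\<lambda>y. - y $ i - (R *v G (transpose R *v y)) $ i)"
  by (intro poly_growth_diff poly_growth_minus poly_growth_component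
      poly_growth_matrix_vector_component poly_growth_orthogonal_transformation[OF G]
      orthogonal_transformation_matrix_transpose R)

text \<open>After the substitution \<open>x = R z\<close> the left-hand side is the quadratic form of \<open>H\<close> at the
  \<open>i\<close>-th row of \<open>R\<close>.\<close>

lemma expect_component_score_difference:
  fixes R :: "real^'n^'n"
  assumes R: "orthogonal_matrix R"
    and L: "\<And>x. ((\<lambda>x. ln (p x)) has_derivative (\<lambda>h. G x \<bullet> h)) (at x)"
    and G: "\<And>k. poly_growth (\<lambda>x. G x $ k)"
  shows "expect std_gauss (\<lambda>x. x $ i * (- x $ i - (R *v G (transpose R *v x)) $ i))
    = - (R ** H_mat p ** transpose R) $ i $ i"
proof -
  define T where "T x = transpose R *v x" for x :: "real^'n"
  define F where "F z = (R *v z) $ i * ((R *v z) $ i + (R *v G z) $ i)" for z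
  note growth = poly_growth_sum poly_growth_mult poly_growth_add poly_growth_const
    poly_growth_component G
  have T: "orthogonal_transformation T"
    using orthogonal_transformation_matrix_transpose[OF R] by (simp add: T_def[abs_def])
  have RT: "R *v T x = x" for x
    using R by (simp add: T_def orthogonal_matrix_def matrix_vector_mul_assoc)
  have F: "F z = (\<Sum>j\<in>UNIV. \<Sum>k\<in>UNIV. (R $ i $ j * R $ i $ k) * (z $ j * (G z $ k + z $ k)))" for z
  proof -
    have "F z = (\<Sum>j\<in>UNIV. R $ i $ j * z $ j) * (\<Sum>k\<in>UNIV. R $ i $ k * (G z $ k + z $ k))"
      by (simp add: F_def matrix_vector_mult_def sum.distrib distrib_left add.commute)
    then show ?thesis by (simp add: sum_product mult_ac)
  qed
  have "poly_growth F"
    unfolding F[abs_def] by (intro growth)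
  then have [measurable]: "F \<in> borel_measurable borel" by (rule poly_growth_measurable)
  \<comment> \<open>Because \<open>R *v T x = x\<close>, the integrand is a function of
    \<open>T x\<close> alone, which makes rotation invariance applicable.\<close>
  have "x $ i * (- x $ i - (R *v G (transpose R *v x)) $ i) = - F (T x)" for x
    unfolding F_def RT by (simp add: T_def algebra_simps)
  then have "expect std_gauss (\<lambda>x. x $ i * (- x $ i - (R *v G (transpose R *v x)) $ i))
      = - expect std_gauss (\<lambda>x. F (T x))"
    by (simp add: expect_uminus)
  also have "expect std_gauss (\<lambda>x. F (T x)) = expect std_gauss F"
    by (rule expect_std_gauss_orthogonal_transformation[OF _ T]) measurable
  also have "\<dots> = (\<Sum>j\<in>UNIV. \<Sum>k\<in>UNIV. (R $ i $ j * R $ i $ k) * H_mat p $ j $ k)"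
  proof -
    have "expect std_gauss F = (\<Sum>j\<in>UNIV. \<Sum>k\<in>UNIV.
        expect std_gauss (\<lambda>z. (R $ i $ j * R $ i $ k) * (z $ j * (G z $ k + z $ k))))"
      unfolding F[abs_def] by (subst expect_std_gauss_sum, intro growth, rule sum.cong[OF refl])
        (rule expect_std_gauss_sum, intro growth)
    then show ?thesis by (simp add: expect_cmult H_mat_def grad_log_eq[OF L])
  qed
  \<comment> \<open>The matrix product has the column index of \<open>H_mat p\<close> as its outer
    summation, hence the exchange of sums.\<close>
  also have "\<dots> = (R ** H_mat p ** transpose R) $ i $ i"
    by (subst sum.swap) (simp add: matrix_matrix_mult_def transpose_def sum_distrib_left mult_ac)
  finally show ?thesis .
qed

section \<open>The score of a centred Gaussian\<close>

lemma pos_def_imp_invertible: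
  assumes "pos_def (S :: real^'n^'n)"
  shows "invertible S"
proof -
  have "x = 0" if "S *v x = 0" for x
    using assms that unfolding pos_def_def by (metis inner_zero_right less_irrefl)
  then show ?thesis
    by (simp add: invertible_left_inverse matrix_left_invertible_ker)
qed

lemma matrix_inv_right:
  assumes "invertible S"
  shows "S ** matrix_inv S = mat 1"
  using someI_ex[OF assms[unfolded invertible_def]] by (simp add: matrix_inv_def)

text \<open>Transposing a right inverse of the symmetric \<open>S\<close> gives a left inverse, and
  a left and a right inverse coincide.\<close>

lemma transpose_matrix_inv_symmetric:
  fixes S :: "real^'n^'n"
  assumes S: "invertible S" "transpose S = S"
  shows "transpose (matrix_inv S) = matrix_inv S"
proof -
  let ?B = "matrix_inv S"
  have B: "S ** ?B = mat 1" using S(1) by (rule matrix_inv_right)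
  have "transpose ?B ** S = mat 1"
    using arg_cong[OF B, of transpose] by (simp add: matrix_transpose_mul S(2))
  then have "transpose ?B ** S ** ?B = ?B" by simp
  then show ?thesis by (simp add: matrix_mul_assoc[symmetric] B)
qed

lemma has_derivative_ln_gauss_density:
  fixes S :: "real^'n^'n"
  assumes S: "pos_def S" and p: "\<And>x. p x = gauss_density S x" and pos: "\<And>x. p x > 0"
  shows "((\<lambda>x. ln (p x)) has_derivative (\<lambda>h. (- (matrix_inv S *v x)) \<bullet> h)) (at x)"
proof -
  let ?B = "matrix_inv S"
  define K where "K = (2 * pi) powr (- real CARD('n) / 2) / sqrt (det S)"
  have p_eq: "p x = K * exp (- (x \<bullet> (?B *v x)) / 2)" for x
    by (simp add: p gauss_density_def K_def)
  \<comment> \<open>Positivity of the normalising constant is read off from \<open>p 0 = K\<close>,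
    so no sign of the determinant has to be established.\<close>
  have "K > 0" using pos[of 0] by (simp add: p_eq)
  then have ln_p: "ln (p x) = ln K - (x \<bullet> (?B *v x)) / 2" for x
    by (simp add: p_eq ln_mult)
  \<comment> \<open>Symmetry of the inverse makes the two product-rule terms of the quadratic form
    equal, which cancels the factor 1/2.\<close>
  have sym: "x \<bullet> (?B *v h) = (?B *v x) \<bullet> h" for h
    using transpose_matrix_inv_symmetric[OF pos_def_imp_invertible[OF S]] S
    by (metis dot_lmul_matrix pos_def_def vector_transpose_matrix)
  have lin: "((\<lambda>x. ?B *v x) has_derivative (\<lambda>h. ?B *v h)) (at x)"
    by (rule bounded_linear_imp_has_derivative) (rule matrix_vector_mul_bounded_linear)
  have "((\<lambda>x. ln K - (x \<bullet> (?B *v x)) / 2) has_derivative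
      (\<lambda>h. - ((x \<bullet> (?B *v h) + h \<bullet> (?B *v x)) / 2))) (at x)"
    by (auto intro!: derivative_eq_intros lin)
  moreover have "- ((x \<bullet> (?B *v h) + h \<bullet> (?B *v x)) / 2) = (- (?B *v x)) \<bullet> h" for h
    using sym[of h] inner_commute[of h "?B *v x"] by simp
  ultimately show ?thesis by (simp only: ln_p)
qed

theorem theorem3:
  fixes p :: "real^'n \<Rightarrow> real"
  assumes pos: "\<forall>x. p x > 0"
    and dens: "(p has_integral 1) UNIV"
    and C1: "\<exists>g :: real^'n \<Rightarrow> real^'n. continuous_on UNIV g \<and>
               (\<forall>x. (p has_derivative (\<lambda>h. g x \<bullet> h)) (at x))"
    and growth: "\<exists>c m. c > 0 \<and> (m::nat) \<ge> 2 \<and>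
               (\<forall>x. \<bar>ln (p x)\<bar> \<le> c * (1 + norm x ^ m) \<and>
                    norm (grad_log p x) \<le> c * (1 + norm x ^ m))"
  shows "(\<forall>R :: real^'n^'n. orthogonal_matrix R \<longrightarrow>
            proj_fisher std_gauss_marg (rot_dens p R)
              \<ge> (\<Sum>i\<in>UNIV. ((R ** H_mat p ** transpose R) $ i $ i)\<^sup>2))
       \<and> (\<forall>S :: real^'n^'n. pos_def S \<and> (\<forall>x. p x = gauss_density S x) \<longrightarrow>
            (\<forall>R :: real^'n^'n. orthogonal_matrix R \<longrightarrow>
               proj_fisher std_gauss_marg (rot_dens p R)
                 = (\<Sum>i\<in>UNIV. ((R ** H_mat p ** transpose R) $ i $ i)\<^sup>2))
            \<and> H_mat p = mat 1 - matrix_inv S)"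
proof (intro conjI allI impI)
  fix R :: "real^'n^'n" assume R: "orthogonal_matrix R"
  obtain g where g: "continuous_on UNIV g" "\<And>x. (p has_derivative (\<lambda>h. g x \<bullet> h)) (at x)"
    using C1 by blast
  obtain c m where c: "c > 0" "\<And>x. norm (grad_log p x) \<le> c * (1 + norm x ^ m)"
    using growth by blast
  \<comment> \<open>This is the gradient of \<open>ln (p x)\<close>. Continuity of \<open>g\<close>
    and \<open>p\<close> gives its measurability, and the growth hypothesis transfers because
    \<open>G\<close> agrees with \<open>grad_log p\<close>.\<close>
  define G where "G x = g x /\<^sub>R p x" for x
  have L: "((\<lambda>x. ln (p x)) has_derivative (\<lambda>h. G x \<bullet> h)) (at x)" for x
    unfolding G_def using g(2) pos by (intro has_derivative_ln_gradient) auto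
  have "continuous_on UNIV p"
    using g(2) by (meson has_derivative_at_withinI has_derivative_continuous_on)
  then have "continuous_on UNIV G"
    unfolding G_def using g(1) pos by (intro continuous_intros) (auto simp: less_imp_neq[symmetric])
  then have meas: "(\<lambda>x. G x $ k) \<in> borel_measurable borel" for k
    by (intro borel_measurable_continuous_onI continuous_intros)
  have G: "poly_growth (\<lambda>x. G x $ k)" for k
  proof (rule poly_growth_norm_power[OF meas])
    show "\<bar>G x $ k\<bar> \<le> c * (1 + norm x ^ m)" for x
      using c(2)[of x] component_le_norm_cart[of "G x" k] by (simp add: grad_log_eq[OF L])
  qed (use c in simp)
  show "(\<Sum>i\<in>UNIV. ((R ** H_mat p ** transpose R) $ i $ i)\<^sup>2) \<le> proj_fisher std_gauss_marg (rot_dens p R)"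
    unfolding proj_fisher_rot_dens[OF L]
  proof (rule sum_mono)
    fix i :: 'n
    show "((R ** H_mat p ** transpose R) $ i $ i)\<^sup>2 \<le> expect std_gauss
      (\<lambda>x. (expect_minus std_gauss_marg (\<lambda>y. - y $ i - (R *v G (transpose R *v y)) $ i) i (x $ i))\<^sup>2)"
      \<comment> \<open>The correlation of the score difference with \<open>x $ i\<close> is minus
        the diagonal entry; squaring removes the sign.\<close>
      using expect_expect_minus_square_ge[OF poly_growth_score_difference[OF R G, of i], of i]
      by (simp add: expect_component_score_difference[OF R L G])
  qed
next
  fix S :: "real^'n^'n" assume "pos_def S \<and> (\<forall>x. p x = gauss_density S x)"
  then have S: "pos_def S" and p: "\<And>x. p x = gauss_density S x" by auto
  let ?B = "matrix_inv S"
  define G where "G x = - (?B *v x)" for x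
  have L: "((\<lambda>x. ln (p x)) has_derivative (\<lambda>h. G x \<bullet> h)) (at x)" for x
    unfolding G_def using has_derivative_ln_gauss_density[OF S p] pos by blast
  have G: "poly_growth (\<lambda>x. G x $ k)" for k
    by (simp add: G_def poly_growth_minus poly_growth_matrix_vector_component poly_growth_component)
  {
    fix R :: "real^'n^'n" assume R: "orthogonal_matrix R"
    \<comment> \<open>\<open>M\<close> is the inverse covariance of the rotated Gaussian, so
      component \<open>i\<close> of the score difference is the linear form given by row
      \<open>i\<close> of \<open>M\<close> minus the identity.\<close>
    define M where "M = R ** ?B ** transpose R"
    show "proj_fisher std_gauss_marg (rot_dens p R) = (\<Sum>i\<in>UNIV. ((R ** H_mat p ** transpose R) $ i $ i)\<^sup>2)"
      unfolding proj_fisher_rot_dens[OF L]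
    proof (rule sum.cong[OF refl])
      fix i :: 'n
      have "- y $ i - (R *v G (transpose R *v y)) $ i = (row i M - axis i 1) \<bullet> y" for y
      proof -
        have "R *v G (transpose R *v y) = - (M *v y)"
          by (simp add: G_def M_def matrix_vector_mul_assoc matrix_mul_assoc linear_neg[OF matrix_vector_mul_linear])
        then show ?thesis
          by (simp add: inner_diff_left inner_axis' matrix_vector_mul_component row_def)
      qed
      then have eq: "(\<lambda>y. - y $ i - (R *v G (transpose R *v y)) $ i) = (\<lambda>y. (row i M - axis i 1) \<bullet> y)"
        by (rule ext)
      show "expect std_gauss
        (\<lambda>x. (expect_minus std_gauss_marg (\<lambda>y. - y $ i - (R *v G (transpose R *v y)) $ i) i (x $ i))\<^sup>2)
        = ((R ** H_mat p ** transpose R) $ i $ i)\<^sup>2"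
        using expect_expect_minus_square_linear[of "row i M - axis i 1" i]
          expect_component_score_difference[OF R L G, of i]
        by (simp add: fun_cong[OF eq] eq)
    qed
  }
  have "H_mat p $ j $ k = mat 1 $ j $ k - ?B $ j $ k" for j k
  proof -
    note growth = poly_growth_sum poly_growth_mult poly_growth_const poly_growth_component
    have "x $ j * (grad_log p x $ k + x $ k) = (\<Sum>l\<in>UNIV. (mat 1 $ k $ l - ?B $ k $ l) * (x $ j * x $ l))"
      for x
    proof -
      have "grad_log p x $ k + x $ k = ((mat 1 - ?B) *v x) $ k"
        by (simp add: grad_log_eq[OF L] G_def matrix_vector_mult_diff_rdistrib)
      then show ?thesis by (simp add: matrix_vector_mult_def sum_distrib_left mult_ac)
    qed
    then have "H_mat p $ j $ k = (\<Sum>l\<in>UNIV. (mat 1 $ k $ l - ?B $ k $ l) * expect std_gauss (\<lambda>x. x $ j * x $ l))"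
      by (simp add: H_mat_def expect_std_gauss_sum growth expect_cmult)
    also have "\<dots> = mat 1 $ k $ j - ?B $ k $ j"
      by (simp add: expect_std_gauss_component_mult if_distrib cong: if_cong)
    \<comment> \<open>The identity covariance selects the entry \<open>(k, j)\<close>; symmetry of
      the inverse turns it into the entry \<open>(j, k)\<close>.\<close>
    also have "\<dots> = mat 1 $ j $ k - ?B $ j $ k"
    proof -
      have "transpose ?B = ?B"
        using S by (intro transpose_matrix_inv_symmetric pos_def_imp_invertible) (auto simp: pos_def_def)
      then have "?B $ k $ j = ?B $ j $ k" by (metis transpose_def vec_lambda_beta)
      then show ?thesis by (simp add: mat_def)
    qed
    finally show ?thesis .
  qed
  then show "H_mat p = mat 1 - ?B" by (simp add: vec_eq_iff)
qed

end
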